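(* Let $\mathbf a\in\mathbb N^n$ be a weak composition and let \[ D_{\mathbf a}=\Big\{(c,r)\in\mathbb Z_{>0}\times[n] \;\Big|\; \sum_{k=1}^{r-1}\mathbf a_k<c\le\sum_{k=1}^{r}\mathbf a_k\Big\}. \] Then the complete flagged homogeneous polynomial $\mathfrak h_{\mathbf a}$ is the character of the flagged Schur module $\mathcal S_{D_{\mathbf a}}$ of the diagram $D_{\mathbf a}$.
   Context: Fix a positive integer $n$ and write $[n]=\{1,\dots,n\}$. A weak composition is $\mathbf a=(\mathbf a_1,\dots,\mathbf a_n)\in\mathbb N^n$; $x^{\mathbf a}=\prod_i x_i^{\mathbf a_i}$. For $k\ge 0$, $h_k(x_1,\dots,x_i)=\sum_{1\le i_1\le\cdots\le i_k\le i}x_{i_1}\cdots x_{i_k}$ is the complete homogeneous symmetric polynomial ($h_0=1$). The complete flagged homogeneous polynomial is $\mathfrak h_{\mathbf a}=\prod_{i\ge1}h_{\mathbf a_i}(x_1,\dots,x_i)$. A diagram is a finite subset of $\mathbb Z_{>0}\times[n]$; its elements $(c,r)$ are cells, $c$ being the column and $r$ the row (row 1 at the bottom). The flagged Schur module (in the sense of Reiner–Shimozono) of a diagram $D$ is defined as follows. Let $B$ be the group of invertible lower triangular $n\times n$ complex matrices and $Y=(y_{ij})$ an $n\times n$ matrix of indeterminates. For $R=\{r_1<\cdots<r_m\}\subseteq[n]$ let $\Delta_R(Y)=\det(y_{r_a,b})_{1\le a,b\le m}$ ($\Delta_\emptyset=1$), and for each column $c$ let $C_c=\{r:(c,r)\in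 D\}$. Then $\mathcal S_D$ is the complex linear span of the polynomials $\prod_c\Delta_{C_c}(bY)$, $b\in B$, which is a $B$-module under the substitutions $Y\mapsto gY$, $g\in B$. Its character is the trace of the linear map $F(Y)\mapsto F(\mathrm{diag}(x_1,\dots,x_n)\,Y)$ on $\mathcal S_D$, a polynomial in $x_1,\dots,x_n$.
   Formalization: The minor of R is taken as det(y_{r_a,r_b}) (rows and columns R, the Reiner–Shimozono convention), not det(y_{r_a,b}) with columns 1..m; with the latter the claim fails for n=3, a=(0,1,1), where the module has dimension 5 but h_a(1,1,1)=6. *)

theory Defs
  imports
    Complex_Main
    "HOL-Library.Poly_Mapping"
    "Jordan_Normal_Form.Determinant"
    "Jordan_Normal_Form.DL_Submatrix"
begin

text \<open>Polynomials over the complex numbers with variables indexed by \<open>'v\<close>: a finitely supported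
  map from monomials to coefficients, with the convolution product of
  \<^theory>\<open>HOL-Library.Poly_Mapping\<close>.\<close>

type_synonym 'v cpoly = "('v \<Rightarrow>\<^sub>0 nat) \<Rightarrow>\<^sub>0 complex"

definition Const :: "complex \<Rightarrow> 'v cpoly" where
  "Const c = Poly_Mapping.single 0 c"

definition Var :: "'v \<Rightarrow> 'v cpoly" where
  "Var v = Poly_Mapping.single (Poly_Mapping.single v 1) 1"

text \<open>Substitution of \<open>s v\<close> for each variable \<open>v\<close>, with values in a commutative algebra whose
  structure map is \<open>h\<close>.\<close>

definition cpoly_subst ::
    "(complex \<Rightarrow> 'r::comm_semiring_1) \<Rightarrow> ('v \<Rightarrow> 'r) \<Rightarrow> 'v cpoly \<Rightarrow> 'r" where
  "cpoly_subst h s p =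
     (\<Sum>m\<in>Poly_Mapping.keys p. h (Poly_Mapping.lookup p m) *
        (\<Prod>v\<in>Poly_Mapping.keys m. s v ^ Poly_Mapping.lookup m v))"

abbreviation cpoly_eval :: "('v \<Rightarrow> complex) \<Rightarrow> 'v cpoly \<Rightarrow> complex" where
  "cpoly_eval \<equiv> cpoly_subst (\<lambda>c. c)"

definition cpoly_scale :: "complex \<Rightarrow> 'v cpoly \<Rightarrow> 'v cpoly" where
  "cpoly_scale c p = Const c * p"

interpretation cpoly: vector_space cpoly_scale
proof
  fix a b :: complex and p q :: "'v cpoly"
  show "cpoly_scale a (p + q) = cpoly_scale a p + cpoly_scale a q"
    by (simp add: cpoly_scale_def distrib_left)
  show "cpoly_scale (a + b) p = cpoly_scale a p + cpoly_scale b p"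
    by (simp add: cpoly_scale_def Const_def single_add distrib_right)
  show "cpoly_scale a (cpoly_scale b p) = cpoly_scale (a * b) p"
    by (simp add: cpoly_scale_def Const_def mult_single flip: mult.assoc)
  show "cpoly_scale 1 p = p"
    by (simp add: cpoly_scale_def Const_def)
qed

text \<open>\<open>T\<close> restricts to an endomorphism of the finite-dimensional space \<open>V\<close>, and \<open>t\<close> is its trace.
  For linear \<open>T\<close> the sum does not depend on the basis.\<close>

definition cpoly_has_trace_on :: "('v cpoly \<Rightarrow> 'v cpoly) \<Rightarrow> 'v cpoly set \<Rightarrow> complex \<Rightarrow> bool" where
  "cpoly_has_trace_on T V t \<longleftrightarrow>
     T ` V \<subseteq> V \<and>
     (\<exists>B. finite B \<and> cpoly.independent B \<and> cpoly.span B = V \<and>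
          t = (\<Sum>b\<in>B. cpoly.representation B (T b) b))"

text \<open>\<open>h\<^sub>k(x\<^sub>1, \<dots>, x\<^sub>i)\<close>, and \<open>\<hh>\<^sub>a\<close> as a polynomial in the variables \<open>x\<^sub>1, \<dots>, x\<^sub>n\<close>.  A weak
  composition is a function of which only the values at \<open>1, \<dots>, n\<close> are used.\<close>

definition complete_homogeneous :: "nat \<Rightarrow> nat \<Rightarrow> (nat \<Rightarrow> 'r::comm_semiring_1) \<Rightarrow> 'r" where
  "complete_homogeneous k i x =
     (\<Sum>js | length js = k \<and> sorted js \<and> set js \<subseteq> {1..i}. \<Prod>j\<leftarrow>js. x j)"

definition flagged_homogeneous :: "nat \<Rightarrow> (nat \<Rightarrow> nat) \<Rightarrow> nat cpoly" where
  "flagged_homogeneous n a = (\<Prod>i=1..n. complete_homogeneous (a i) i Var)"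

text \<open>A diagram is a finite set of cells (column, row), both counted from 1.\<close>

definition composition_diagram :: "nat \<Rightarrow> (nat \<Rightarrow> nat) \<Rightarrow> (nat \<times> nat) set" where
  "composition_diagram n a =
     {(c, r). 0 < c \<and> r \<in> {1..n} \<and> (\<Sum>k\<in>{1..<r}. a k) < c \<and> c \<le> (\<Sum>k\<in>{1..r}. a k)}"

definition diagram_column :: "(nat \<times> nat) set \<Rightarrow> nat \<Rightarrow> nat set" where
  "diagram_column D c = {r. (c, r) \<in> D}"

text \<open>Matrix indices start at 0: the variable \<open>(i, j)\<close> is the indeterminate in row \<open>i + 1\<close> and column
  \<open>j + 1\<close> of \<open>Y\<close>.\<close>

definition generic_matrix :: "nat \<Rightarrow> (nat \<times> nat) cpoly mat" where
  "generic_matrix n = mat n n Var"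

definition lower_borel :: "nat \<Rightarrow> complex mat set" where
  "lower_borel n = {b \<in> carrier_mat n n. invertible_mat b \<and> upper_triangular (transpose_mat b)}"

definition translate_generic :: "nat \<Rightarrow> complex mat \<Rightarrow> (nat \<times> nat) cpoly mat" where
  "translate_generic n g = map_mat Const g * generic_matrix n"

text \<open>\<open>F(Y) \<mapsto> F(gY)\<close>, for polynomials \<open>F\<close> in the entries of \<open>Y\<close>.\<close>

definition borel_act :: "nat \<Rightarrow> complex mat \<Rightarrow> (nat \<times> nat) cpoly \<Rightarrow> (nat \<times> nat) cpoly" where
  "borel_act n g = cpoly_subst Const (\<lambda>ij. translate_generic n g $$ ij)"

text \<open>The minor attached to a column \<open>R = {r\<^sub>1 < \<dots> < r\<^sub>m}\<close> of a diagram is the principal minor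
  \<open>det (y\<^bsub>r\<^sub>a r\<^sub>b\<^esub>)\<close>, the convention of Reiner and Shimozono.  The left-justified minors
  \<open>det (y\<^bsub>r\<^sub>a b\<^esub>)\<close> (columns \<open>1, \<dots>, m\<close> of \<open>Y\<close>) give a different, in general smaller, module: for the
  diagram of the composition \<open>(0, 1, 1)\<close> they would give the span of the products
  \<open>(b\<^sub>2\<^sub>1 y\<^sub>1\<^sub>1 + b\<^sub>2\<^sub>2 y\<^sub>2\<^sub>1) (b\<^sub>3\<^sub>1 y\<^sub>1\<^sub>1 + b\<^sub>3\<^sub>2 y\<^sub>2\<^sub>1 + b\<^sub>3\<^sub>3 y\<^sub>3\<^sub>1)\<close>, which has dimension 5, whereas
  \<open>h\<^sub>1(x\<^sub>1, x\<^sub>2) h\<^sub>1(x\<^sub>1, x\<^sub>2, x\<^sub>3)\<close> has 6 terms.\<close>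

definition diagram_minor :: "nat set \<Rightarrow> 'r::comm_ring_1 mat \<Rightarrow> 'r" where
  "diagram_minor R M = det (submatrix M {i. Suc i \<in> R} {i. Suc i \<in> R})"

text \<open>The product runs over the nonempty columns only; an empty column would contribute 1.\<close>

definition flagged_schur_module :: "nat \<Rightarrow> (nat \<times> nat) set \<Rightarrow> (nat \<times> nat) cpoly set" where
  "flagged_schur_module n D =
     cpoly.span ((\<lambda>b. \<Prod>c\<in>fst ` D. diagram_minor (diagram_column D c) (translate_generic n b))
                 ` lower_borel n)"

text \<open>\<open>p\<close> is the character of the module \<open>V\<close>: its value at each \<open>x\<close> with \<open>x\<^sub>1, \<dots>, x\<^sub>n\<close> nonzero is the
  trace of \<open>F(Y) \<mapsto> F(diag(x\<^sub>1, \<dots>, x\<^sub>n) Y)\<close> on \<open>V\<close>.  There is at most one such polynomial, and it only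
  involves \<open>x\<^sub>1, \<dots>, x\<^sub>n\<close>, because the values of \<open>x\<close> at all other indices are arbitrary.\<close>

definition is_borel_character :: "nat \<Rightarrow> (nat \<times> nat) cpoly set \<Rightarrow> nat cpoly \<Rightarrow> bool" where
  "is_borel_character n V p \<longleftrightarrow>
     (\<forall>x. (\<forall>i\<in>{1..n}. x i \<noteq> 0) \<longrightarrow>
        cpoly_has_trace_on (borel_act n (mat_diag n (\<lambda>i. x (Suc i)))) V (cpoly_eval x p))"

end

theory Submission
  imports Defs
begin

text \<open>Every column of the diagram has a single cell, so the minor of a column in row \<open>i\<close> is the linear
  form \<open>\<Sum>\<^bsub>j \<le> i\<^esub> b\<^bsub>ij\<^esub> y\<^bsub>ji\<^esub>\<close>, and the module is spanned by the products over \<open>i\<close> of the \<open>a\<^sub>i\<close>-th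
  powers of these forms.  In the expansion of such a product every monomial of degree \<open>a\<^sub>i\<close> in
  \<open>y\<^bsub>1i\<^esub>, \<dots>, y\<^bsub>ii\<^esub>\<close> for each \<open>i\<close> occurs, with a positive multinomial coefficient times the same
  monomial in the entries of \<open>b\<close>.  Since these entries vary independently, the module contains
  each of the monomials, which thus form a basis of weight vectors; summing their weights over all
  choices gives \<open>\<Prod>\<^sub>i h\<^bsub>a i\<^esub>(x\<^sub>1, \<dots>, x\<^sub>i)\<close>.\<close>

section \<open>Evaluation of monomials and substitution into polynomials\<close>

definition monom_eval :: "('v \<Rightarrow> 'r::comm_semiring_1) \<Rightarrow> ('v \<Rightarrow>\<^sub>0 nat) \<Rightarrow> 'r" where
  "monom_eval s m = (\<Prod>v\<in>Poly_Mapping.keys m. s v ^ Poly_Mapping.lookup m v)"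

text \<open>Exponents outside the support are 0 and give factors 1, so monomials with different
  supports can be compared over a common index set.\<close>

lemma monom_eval_superset:
  assumes "finite A" "Poly_Mapping.keys m \<subseteq> A"
  shows "monom_eval s m = (\<Prod>v\<in>A. s v ^ Poly_Mapping.lookup m v)"
  unfolding monom_eval_def
  by (rule prod.mono_neutral_left) (use assms in \<open>auto simp: in_keys_iff\<close>)

lemma monom_eval_0 [simp]: "monom_eval s 0 = 1"
  by (simp add: monom_eval_def)

lemma monom_eval_single [simp]: "monom_eval s (Poly_Mapping.single v k) = s v ^ k"
  by (simp add: monom_eval_def)

lemma monom_eval_add: "monom_eval s (m + m') = monom_eval s m * monom_eval s m'"
proof -
  let ?A = "Poly_Mapping.keys m \<union> Poly_Mapping.keys m'"
  have "monom_eval s (m + m') = (\<Prod>v\<in>?A. s v ^ Poly_Mapping.lookup (m + m') v)"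
    by (rule monom_eval_superset) (use keys_add[of m m'] in auto)
  also have "\<dots> = monom_eval s m * monom_eval s m'"
    by (simp add: monom_eval_superset[of ?A] lookup_add power_add prod.distrib)
  finally show ?thesis .
qed

lemma monom_eval_sum: "monom_eval s (sum f A) = (\<Prod>i\<in>A. monom_eval s (f i))"
  by (induction A rule: infinite_finite_induct) (auto simp: monom_eval_add)

lemma monom_eval_sum_list: "monom_eval s (\<Sum>j\<leftarrow>js. f j) = (\<Prod>j\<leftarrow>js. monom_eval s (f j))"
  by (induction js) (auto simp: monom_eval_add)

text \<open>Rescaling one value makes the exponent of that variable visible as a power of
  \<open>c\<close>; the elimination of monomials below rests on this.\<close>

lemma monom_eval_fun_upd:
  "monom_eval (s(v := c * s v)) m = c ^ Poly_Mapping.lookup m v * monom_eval s m"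
proof -
  let ?A = "insert v (Poly_Mapping.keys m)"
  have "monom_eval (s(v := c * s v)) m
      = (\<Prod>u\<in>?A. (if u = v then c ^ Poly_Mapping.lookup m v else 1) * s u ^ Poly_Mapping.lookup m u)"
    unfolding monom_eval_superset[of ?A m, OF _ subset_insertI, simplified]
    by (rule prod.cong) (auto simp: power_mult_distrib)
  also have "\<dots> = c ^ Poly_Mapping.lookup m v * (\<Prod>u\<in>?A. s u ^ Poly_Mapping.lookup m u)"
    by (simp only: prod.distrib) (simp add: prod.delta)
  finally show ?thesis
    by (subst (2) monom_eval_superset[of ?A]) auto
qed

lemma cpoly_subst_single:
  assumes "h 0 = 0"
  shows "cpoly_subst h s (Poly_Mapping.single m c) = h c * monom_eval s m"
  using assms by (cases "c = 0") (auto simp: cpoly_subst_def monom_eval_def)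

lemma cpoly_subst_superset:
  assumes "h 0 = 0" "finite A" "Poly_Mapping.keys p \<subseteq> A"
  shows "cpoly_subst h s p = (\<Sum>m\<in>A. h (Poly_Mapping.lookup p m) * monom_eval s m)"
  unfolding cpoly_subst_def monom_eval_def
  by (rule sum.mono_neutral_left) (use assms in \<open>auto simp: in_keys_iff\<close>)

text \<open>Cancellation may shrink the support of \<open>p + q\<close>, so all three sums are taken
  over the union of the supports, where \<open>h 0 = 0\<close> kills the extra terms.\<close>

lemma cpoly_subst_add:
  assumes "h 0 = 0" "\<And>b c. h (b + c) = h b + h c"
  shows "cpoly_subst h s (p + q) = cpoly_subst h s p + cpoly_subst h s q"
proof -
  let ?A = "Poly_Mapping.keys p \<union> Poly_Mapping.keys q"
  have "cpoly_subst h s (p + q) = (\<Sum>m\<in>?A. h (Poly_Mapping.lookup (p + q) m) * monom_eval s m)"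
    by (rule cpoly_subst_superset) (use keys_add[of p q] assms in auto)
  then show ?thesis
    by (simp add: cpoly_subst_superset[of h ?A] assms lookup_add distrib_right sum.distrib)
qed

lemma cpoly_subst_sum:
  assumes "h 0 = 0" "\<And>b c. h (b + c) = h b + h c"
  shows "cpoly_subst h s (sum f A) = (\<Sum>i\<in>A. cpoly_subst h s (f i))"
proof (induction A rule: infinite_finite_induct)
  case (insert i A)
  then show ?case by (simp add: cpoly_subst_add assms)
qed (auto simp: cpoly_subst_def)

lemma Const_0 [simp]: "Const 0 = 0"
  by (simp add: Const_def)

lemma Const_add: "Const (b + c) = Const b + Const c"
  by (simp add: Const_def single_add)

lemma cpoly_scale_single:
  "cpoly_scale c (Poly_Mapping.single m d) = Poly_Mapping.single m (c * d)"
  by (simp add: cpoly_scale_def Const_def mult_single)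

lemma prod_single:
  "(\<Prod>i\<in>A. Poly_Mapping.single (m i) (c i)) = (Poly_Mapping.single (sum m A) (prod c A) :: 'v cpoly)"
  by (induction A rule: infinite_finite_induct) (auto simp: mult_single)

lemma prod_list_single:
  "(\<Prod>i\<leftarrow>is. Poly_Mapping.single (m i) (c i))
    = (Poly_Mapping.single (\<Sum>i\<leftarrow>is. m i) (\<Prod>i\<leftarrow>is. c i) :: 'v cpoly)"
  by (induction "is") (auto simp: mult_single)

lemma single_one_eq_iff:
  "(Poly_Mapping.single m (1::'b::zero_neq_one)) = Poly_Mapping.single m' 1 \<longleftrightarrow> m = m'"
  by (metis lookup_single_eq lookup_single_not_eq zero_neq_one)

section \<open>Independence of monomials and extraction of single terms\<close>

lemma independent_monomials:
  "cpoly.independent ((\<lambda>m. Poly_Mapping.single m 1) ` M)"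
  unfolding cpoly.independent_explicit_module
proof (intro allI impI)
  fix t :: "'a cpoly set" and u v
  assume t: "finite t" "t \<subseteq> (\<lambda>m. Poly_Mapping.single m 1) ` M"
    and sum: "(\<Sum>w\<in>t. cpoly_scale (u w) w) = 0" and v: "v \<in> t"
  then obtain m where m: "v = Poly_Mapping.single m 1"
    by blast
  \<comment> \<open>Reading off the coefficient of \<open>m\<close> isolates \<open>u v\<close>,
    since every other member of \<open>t\<close> is a different monomial.\<close>
  have "(\<Sum>w\<in>t. Poly_Mapping.lookup (cpoly_scale (u w) w) m) = (\<Sum>w\<in>t. if w = v then u v else 0)"
  proof (rule sum.cong)
    fix w assume "w \<in> t"
    then obtain m' where "w = Poly_Mapping.single m' 1"
      using t(2) by blast
    then show "Poly_Mapping.lookup (cpoly_scale (u w) w) m = (if w = v then u v else 0)"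
      by (cases "m' = m") (auto simp: m cpoly_scale_single lookup_single single_one_eq_iff)
  qed simp
  with sum t(1) v show "u v = 0"
    by (simp flip: lookup_sum)
qed

text \<open>Doubling the value of one variable multiplies a monomial by a power of 2, so a suitable linear
  combination of two evaluations eliminates one monomial and keeps another.\<close>

lemma monomial_coefficients_in_subspace:
  fixes u :: "('v \<Rightarrow>\<^sub>0 nat) \<Rightarrow> 'w cpoly"
  assumes "cpoly.subspace W" "finite M" "m \<in> M"
    and "\<And>\<beta>. (\<And>v. \<beta> v \<noteq> 0) \<Longrightarrow> (\<Sum>k\<in>M. cpoly_scale (monom_eval \<beta> k) (u k)) \<in> W"
  shows "u m \<in> W"
  using assms(2-4)
proof (induction "card M" arbitrary: M u rule: less_induct)
  case less
  show ?case
  proof (cases "M = {m}")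
    case True
    then show ?thesis
      \<comment> \<open>At the all-ones assignment every monomial has value 1, so the hypothesis
        speaks of \<open>u m\<close> itself.\<close>
      using less.prems(3)[of "\<lambda>_. 1"] by (simp add: monom_eval_def)
  next
    case False
    then obtain m' where m': "m' \<in> M" "m' \<noteq> m"
      using less.prems by auto
    then obtain v where v: "Poly_Mapping.lookup m v \<noteq> Poly_Mapping.lookup m' v"
      by (metis poly_mapping_eqI)
    define d :: "('v \<Rightarrow>\<^sub>0 nat) \<Rightarrow> complex" where
      "d k = 2 ^ Poly_Mapping.lookup k v - 2 ^ Poly_Mapping.lookup m' v" for k
    have "cpoly_scale (d m) (u m) \<in> W"
    \<comment> \<open>Since \<open>d m'\<close> is 0, the combination lives on
      \<open>M - {m'}\<close>; the induction hypothesis is applied to the vectors \<open>u k\<close>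
      rescaled by \<open>d k\<close>.\<close>
    proof (rule less.hyps[where M = "M - {m'}" and u = "\<lambda>k. cpoly_scale (d k) (u k)"])
      fix \<beta> :: "'v \<Rightarrow> complex"
      assume nz: "\<And>v. \<beta> v \<noteq> 0"
      let ?F = "\<lambda>\<beta>. \<Sum>k\<in>M. cpoly_scale (monom_eval \<beta> k) (u k)"
      have "?F (\<beta>(v := 2 * \<beta> v)) - cpoly_scale (2 ^ Poly_Mapping.lookup m' v) (?F \<beta>) \<in> W"
        by (intro cpoly.subspace_diff cpoly.subspace_scale assms(1) less.prems(3)) (auto simp: nz)
      also have "?F (\<beta>(v := 2 * \<beta> v)) - cpoly_scale (2 ^ Poly_Mapping.lookup m' v) (?F \<beta>)
          = (\<Sum>k\<in>M. cpoly_scale (monom_eval \<beta> k) (cpoly_scale (d k) (u k)))"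
        by (simp add: monom_eval_fun_upd d_def cpoly.scale_sum_right flip: sum_subtractf)
           (simp add: algebra_simps cpoly.scale_left_diff_distrib)
      also have "\<dots> = (\<Sum>k\<in>M-{m'}. cpoly_scale (monom_eval \<beta> k) (cpoly_scale (d k) (u k)))"
        by (rule sum.mono_neutral_right) (use less.prems in \<open>auto simp: d_def\<close>)
      finally show "(\<Sum>k\<in>M-{m'}. cpoly_scale (monom_eval \<beta> k) (cpoly_scale (d k) (u k))) \<in> W" .
    qed (use less.prems m' in \<open>auto simp: card_gt_0_iff intro!: diff_less\<close>)
    then have "cpoly_scale (inverse (d m)) (cpoly_scale (d m) (u m)) \<in> W"
      by (rule cpoly.subspace_scale[OF assms(1)])
    moreover have "d m \<noteq> 0"
    proof
      assume "d m = 0"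
      \<comment> \<open>Over the natural numbers, injectivity of powers of 2 contradicts the
        different exponents of \<open>v\<close>.\<close>
      then have "of_nat (2 ^ Poly_Mapping.lookup m v)
          = (of_nat (2 ^ Poly_Mapping.lookup m' v) :: complex)"
        by (simp add: d_def)
      with v show False
        by (simp only: of_nat_eq_iff) simp
    qed
    ultimately show ?thesis by simp
  qed
qed

section \<open>Powers of sums expanded over sorted words\<close>

text \<open>Sorted words stand for multisets, that is, for monomials of degree \<open>k\<close> in
  variables indexed by \<open>J\<close>.\<close>

definition sorted_words :: "nat \<Rightarrow> nat set \<Rightarrow> nat list set" where
  "sorted_words k J = {js. length js = k \<and> sorted js \<and> set js \<subseteq> J}"

text \<open>For a sorted word over \<open>J\<close> of length \<open>k\<close> this is a multinomial
  coefficient, the number of its distinct rearrangements.\<close>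

definition arrangements :: "nat \<Rightarrow> nat set \<Rightarrow> nat list \<Rightarrow> nat" where
  "arrangements k J js = card {is \<in> {is. set is \<subseteq> J \<and> length is = k}. sort is = js}"

lemma finite_sorted_words [simp]: "finite J \<Longrightarrow> finite (sorted_words k J)"
  by (rule finite_subset[OF _ finite_lists_length_eq[of J k]]) (auto simp: sorted_words_def)

lemma arrangements_pos:
  assumes "finite J" "js \<in> sorted_words k J"
  shows "arrangements k J js > 0"
proof -
  have "finite {is \<in> {is. set is \<subseteq> J \<and> length is = k}. sort is = js}"
    by (rule finite_subset[OF _ finite_lists_length_eq[OF assms(1), of k]]) auto
  moreover have "js \<in> {is \<in> {is. set is \<subseteq> J \<and> length is = k}. sort is = js}"
    using assms(2) by (auto simp: sorted_words_def sorted_sort_id)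
  ultimately show ?thesis
    unfolding arrangements_def card_gt_0_iff by blast
qed

lemma power_sum_words:
  fixes z :: "'i \<Rightarrow> 'r::comm_semiring_1"
  assumes "finite J"
  shows "sum z J ^ k = (\<Sum>is | set is \<subseteq> J \<and> length is = k. \<Prod>i\<leftarrow>is. z i)"
proof (induction k)
  case 0
  have "{is. set is \<subseteq> J \<and> is = []} = {[]}" by auto
  then show ?case by simp
next
  case (Suc k)
  have "(\<Sum>is | set is \<subseteq> J \<and> length is = Suc k. \<Prod>i\<leftarrow>is. z i)
      = (\<Sum>(i, is)\<in>J \<times> {is. set is \<subseteq> J \<and> length is = k}. z i * (\<Prod>i\<leftarrow>is. z i))"
    by (rule sum.reindex_bij_witness[of _ "\<lambda>(i, is). i # is" "\<lambda>is. (hd is, tl is)"])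
       (auto simp: length_Suc_conv)
  then show ?case
    using Suc by (simp add: sum_product sum.cartesian_product)
qed

text \<open>Commutativity makes a product invariant under sorting, so the words of the plain
  expansion can be grouped into the fibres of \<open>sort\<close>.\<close>

lemma power_sum_sorted_words:
  fixes z :: "nat \<Rightarrow> 'r::comm_semiring_1"
  assumes "finite J"
  shows "sum z J ^ k = (\<Sum>js\<in>sorted_words k J. of_nat (arrangements k J js) * (\<Prod>j\<leftarrow>js. z j))"
proof -
  have sort: "(\<Prod>i\<leftarrow>sort is. z i) = (\<Prod>i\<leftarrow>is. z i)" for "is"
    by (metis mset_map mset_sort prod_mset_prod_list)
  have "sum z J ^ k = (\<Sum>is | set is \<subseteq> J \<and> length is = k. \<Prod>i\<leftarrow>sort is. z i)"
    by (simp add: power_sum_words[OF assms] sort)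
  also have "\<dots> = (\<Sum>js\<in>sorted_words k J. of_nat (arrangements k J js) * (\<Prod>j\<leftarrow>js. z j))"
    unfolding arrangements_def
    by (rule sum_fun_comp)
       (use assms in \<open>simp_all add: finite_lists_length_eq, auto simp: sorted_words_def\<close>)
  finally show ?thesis .
qed

section \<open>Families of words and their monomials\<close>

text \<open>Extensional functions make a family determined by its values on \<open>{1..n}\<close>,
  as finiteness and the injectivity of \<open>family_monom\<close> require.\<close>

definition word_families :: "nat \<Rightarrow> (nat \<Rightarrow> nat) \<Rightarrow> (nat \<Rightarrow> nat list) set" where
  "word_families n a = (\<Pi>\<^sub>E i\<in>{1..n}. sorted_words (a i) {1..i})"

lemma finite_word_families [simp]: "finite (word_families n a)"
  by (simp add: word_families_def finite_PiE)

text \<open>A letter \<open>j\<close> of the word at \<open>i\<close> stands for the indeterminate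
  in row \<open>j\<close> and column \<open>i\<close> of Y; the subtractions pass to indices from
  0.\<close>

definition family_monom :: "nat \<Rightarrow> (nat \<Rightarrow> nat list) \<Rightarrow> (nat \<times> nat) \<Rightarrow>\<^sub>0 nat" where
  "family_monom n g = (\<Sum>i=1..n. \<Sum>j\<leftarrow>g i. Poly_Mapping.single (j - 1, i - 1) 1)"

lemma monom_eval_family:
  "monom_eval s (family_monom n g) = (\<Prod>i=1..n. \<Prod>j\<leftarrow>g i. s (j - 1, i - 1))"
  by (simp add: family_monom_def monom_eval_sum monom_eval_sum_list)

lemma lookup_sum_list_single:
  "Poly_Mapping.lookup (\<Sum>j\<leftarrow>js. Poly_Mapping.single (f j) (1::nat)) v
    = length (filter (\<lambda>j. f j = v) js)"
  by (induction js) (auto simp: lookup_add lookup_single)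

lemma lookup_family_monom:
  assumes "g \<in> word_families n a" "i \<in> {1..n}" "j > 0"
  shows "Poly_Mapping.lookup (family_monom n g) (j - 1, i - 1) = count_list (g i) j"
proof -
  have "Poly_Mapping.lookup (family_monom n g) (j - 1, i - 1)
      = (\<Sum>k=1..n. length (filter (\<lambda>l. (l - 1, k - 1) = (j - 1, i - 1)) (g k)))"
    by (simp only: family_monom_def lookup_sum lookup_sum_list_single)
  also have "\<dots> = (\<Sum>k=1..n. if k = i then length (filter (\<lambda>l. l - 1 = j - 1) (g i)) else 0)"
    by (rule sum.cong) (use assms(2) in \<open>auto simp: filter_empty_conv\<close>)
  also have "\<dots> = length (filter (\<lambda>l. l - 1 = j - 1) (g i))"
    using assms(2) by simp
  \<comment> \<open>On naturals \<open>0 - 1 = 1 - 1\<close>, so the subtraction can be cancelled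
    only because both letters are positive.\<close>
  also have "filter (\<lambda>l. l - 1 = j - 1) (g i) = filter (\<lambda>l. j = l) (g i)"
  proof (rule filter_cong)
    fix l assume "l \<in> set (g i)"
    moreover have "g i \<in> sorted_words (a i) {1..i}"
      using assms(1,2) by (auto simp: word_families_def)
    ultimately have "l > 0"
      by (fastforce simp: sorted_words_def)
    then show "(l - 1 = j - 1) = (j = l)"
      using assms(3) by auto
  qed simp
  finally show ?thesis
    by (simp add: count_list_eq_length_filter)
qed

text \<open>The exponents in column \<open>i\<close> count the letters of the word at
  \<open>i\<close>; the counts fix its multiset, and a sorted word is fixed by its multiset.\<close>

lemma inj_on_family_monom: "inj_on (family_monom n) (word_families n a)"
proof (rule inj_onI)
  fix g g' assume g: "g \<in> word_families n a" and g': "g' \<in> word_families n a"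
    and eq: "family_monom n g = family_monom n g'"
  have "g i = g' i" if i: "i \<in> {1..n}" for i
  proof -
    have gi: "g i \<in> sorted_words (a i) {1..i}" "g' i \<in> sorted_words (a i) {1..i}"
      using g g' i by (auto simp: word_families_def)
    have "count_list (g i) j = count_list (g' i) j" for j
    proof (cases "j = 0")
      case True
      then have "j \<notin> set (g i)" "j \<notin> set (g' i)"
        using gi by (auto simp: sorted_words_def)
      then show ?thesis by (simp add: count_list_0_iff)
    next
      case False
      then show ?thesis
        using lookup_family_monom[OF g i, of j] lookup_family_monom[OF g' i, of j] eq by simp
    qed
    then have "mset (g i) = mset (g' i)"
      by (intro multiset_eqI) (simp add: count_mset)
    then show ?thesis
      using gi by (metis (mono_tags, lifting) mem_Collect_eq properties_for_sort sorted_words_def)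
  qed
  then show "g = g'"
    using g g' unfolding word_families_def by (intro PiE_ext) auto
qed

section \<open>The flagged homogeneous polynomial as a sum over families\<close>

text \<open>Distributing the product gives one term per family. Different families may yield the
  same monomial here, so indexing by families keeps the multiplicities.\<close>

lemma flagged_homogeneous_word_families:
  "flagged_homogeneous n a
    = (\<Sum>g\<in>word_families n a.
        Poly_Mapping.single (\<Sum>i=1..n. \<Sum>j\<leftarrow>g i. Poly_Mapping.single j 1) 1)"
proof -
  have "flagged_homogeneous n a
      = (\<Prod>i=1..n. \<Sum>js\<in>sorted_words (a i) {1..i}. \<Prod>j\<leftarrow>js. Var j)"
    by (simp add: flagged_homogeneous_def complete_homogeneous_def sorted_words_def)
  also have "\<dots> = (\<Sum>g\<in>word_families n a. \<Prod>i=1..n. \<Prod>j\<leftarrow>g i. Var j)"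
    unfolding word_families_def by (rule prod_sum_PiE) auto
  finally show ?thesis
    by (simp add: Var_def prod_list_single prod_single map_replicate_const prod_list_replicate)
qed

text \<open>An indeterminate in row \<open>j\<close> of Y has weight \<open>x j\<close> whatever its
  column, so the weight of a family's monomial is the value of its term.\<close>

lemma eval_flagged_homogeneous:
  "cpoly_eval x (flagged_homogeneous n a)
    = (\<Sum>g\<in>word_families n a. monom_eval (\<lambda>(j, i). x (Suc j)) (family_monom n g))"
proof -
  have "(\<Prod>i=1..n. \<Prod>j\<leftarrow>g i. x j) = (\<Prod>i=1..n. \<Prod>j\<leftarrow>g i. x (Suc (j - 1)))"
    if "g \<in> word_families n a" for g
  proof (rule prod.cong)
    fix i assume i: "i \<in> {1..n}"
    have "j > 0" if "j \<in> set (g i)" for j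
      using that i \<open>g \<in> word_families n a\<close> by (fastforce simp: word_families_def sorted_words_def)
    then show "(\<Prod>j\<leftarrow>g i. x j) = (\<Prod>j\<leftarrow>g i. x (Suc (j - 1)))"
      by (intro arg_cong[of _ _ prod_list] map_cong) auto
  qed simp
  then show ?thesis
    by (simp add: flagged_homogeneous_word_families cpoly_subst_sum cpoly_subst_single
        monom_eval_sum monom_eval_sum_list monom_eval_family cong: sum.cong)
qed

section \<open>Linear forms on the diagonal and their products\<close>

text \<open>\<open>\<beta>\<close> is indexed like the variables, hence transposed relative to the
  group element, so that \<open>monom_eval \<beta>\<close> applies to monomials in the entries of
  Y.\<close>

definition column_form :: "(nat \<times> nat \<Rightarrow> complex) \<Rightarrow> nat \<Rightarrow> (nat \<times> nat) cpoly" where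
  "column_form \<beta> i = (\<Sum>j=1..i. Const (\<beta> (j - 1, i - 1)) * Var (j - 1, i - 1))"

text \<open>One sorted word from each power makes a family, and the values of \<open>\<beta>\<close>
  collect into the same monomial as the variables. Keeping them outside as scalars gives the shape
  that \<open>monomial_coefficients_in_subspace\<close> expects.\<close>

lemma prod_column_form:
  "(\<Prod>i=1..n. column_form \<beta> i ^ a i)
    = (\<Sum>g\<in>word_families n a. cpoly_scale (monom_eval \<beta> (family_monom n g))
        (Poly_Mapping.single (family_monom n g)
          (of_nat (\<Prod>i=1..n. arrangements (a i) {1..i} (g i)))))"
proof -
  have "(\<Prod>i=1..n. column_form \<beta> i ^ a i)
      = (\<Prod>i=1..n. \<Sum>js\<in>sorted_words (a i) {1..i}. of_nat (arrangements (a i) {1..i} js) *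
          (\<Prod>j\<leftarrow>js. Poly_Mapping.single (Poly_Mapping.single (j - 1, i - 1) 1) (\<beta> (j - 1, i - 1))))"
    by (simp add: column_form_def power_sum_sorted_words Const_def Var_def mult_single)
  also have "\<dots> = (\<Prod>i=1..n. \<Sum>js\<in>sorted_words (a i) {1..i}.
      Poly_Mapping.single (\<Sum>j\<leftarrow>js. Poly_Mapping.single (j - 1, i - 1) 1)
        (of_nat (arrangements (a i) {1..i} js) * (\<Prod>j\<leftarrow>js. \<beta> (j - 1, i - 1))))"
    by (simp add: prod_list_single mult_single flip: single_of_nat)
  also have "\<dots> = (\<Sum>g\<in>word_families n a. \<Prod>i=1..n.
      Poly_Mapping.single (\<Sum>j\<leftarrow>g i. Poly_Mapping.single (j - 1, i - 1) 1)
        (of_nat (arrangements (a i) {1..i} (g i)) * (\<Prod>j\<leftarrow>g i. \<beta> (j - 1, i - 1))))"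
    unfolding word_families_def by (rule prod_sum_PiE) auto
  finally show ?thesis
    unfolding monom_eval_family unfolding family_monom_def
    by (simp add: prod_single cpoly_scale_single prod.distrib mult.commute)
qed

lemma translate_generic_diagonal:
  assumes "b \<in> lower_borel n" "i \<in> {1..n}"
  shows "translate_generic n b $$ (i - 1, i - 1) = column_form (\<lambda>(j, k). b $$ (k, j)) i"
proof -
  have b: "b \<in> carrier_mat n n" "\<And>j k. k < n \<Longrightarrow> j < k \<Longrightarrow> b $$ (j, k) = 0"
    using assms(1) unfolding lower_borel_def upper_triangular_def by auto
  have "translate_generic n b $$ (i - 1, i - 1)
      = (\<Sum>k=0..<n. Const (b $$ (i - 1, k)) * Var (k, i - 1))"
    using b(1) assms(2)
    by (auto simp: translate_generic_def generic_matrix_def scalar_prod_def intro!: sum.cong)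
  \<comment> \<open>Lower triangularity kills the entries right of the diagonal; counted from 0, row
    \<open>i - 1\<close> keeps the columns below \<open>i\<close>.\<close>
  also have "\<dots> = (\<Sum>k=0..<i. Const (b $$ (i - 1, k)) * Var (k, i - 1))"
    by (rule sum.mono_neutral_right) (use assms(2) b(2) in auto)
  also have "\<dots> = column_form (\<lambda>(j, k). b $$ (k, j)) i"
    unfolding column_form_def
    by (rule sum.reindex_bij_witness[of _ "\<lambda>j. j - 1" Suc]) auto
  finally show ?thesis .
qed

section \<open>Minors and columns of the diagram\<close>

lemma diagram_minor_singleton:
  assumes "M \<in> carrier_mat n n" "i \<in> {1..n}"
  shows "diagram_minor {i} M = M $$ (i - 1, i - 1)"
proof -
  obtain p where p: "i = Suc p" "p < n"
    using assms(2) by (cases i) auto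
  have I: "{k. Suc k \<in> {i}} = {p}" and rows: "{k. k = p \<and> k < n} = {p}"
    using p by auto
  \<comment> \<open>\<open>submatrix\<close> reaches its entries through \<open>pick\<close>, the
    increasing enumeration of the selected indices.\<close>
  have pick: "pick {p} 0 = p"
    by (simp add: Least_equality)
  have "submatrix M {p} {p} = mat 1 1 (\<lambda>_. M $$ (p, p))"
    using assms(1) by (intro eq_matI) (auto simp: submatrix_def conj_commute rows pick simp del: pick.simps)
  then show ?thesis
    unfolding diagram_minor_def I using p by (simp add: det_single)
qed

lemma mem_composition_diagram:
  "(c, r) \<in> composition_diagram n a
    \<longleftrightarrow> r \<in> {1..n} \<and> c \<in> {(\<Sum>k\<in>{1..<r}. a k)<..(\<Sum>k\<in>{1..r}. a k)}"
  by (auto simp: composition_diagram_def)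

lemma fst_composition_diagram:
  "fst ` composition_diagram n a
    = (\<Union>r\<in>{1..n}. {(\<Sum>k\<in>{1..<r}. a k)<..(\<Sum>k\<in>{1..r}. a k)})"
  by (simp only: set_eq_iff image_iff Bex_def UN_iff split_paired_Ex fst_conv
      mem_composition_diagram) blast

text \<open>For \<open>r < s\<close> the set \<open>{1..r}\<close> lies inside
  \<open>{1..<s}\<close>, so the partial sums separate the two intervals.\<close>

lemma composition_columns_disjoint:
  fixes a :: "nat \<Rightarrow> nat"
  assumes "c \<in> {(\<Sum>k\<in>{1..<r}. a k)<..(\<Sum>k\<in>{1..r}. a k)}"
    and "c \<in> {(\<Sum>k\<in>{1..<s}. a k)<..(\<Sum>k\<in>{1..s}. a k)}"
  shows "r = s"
proof (rule ccontr)
  have *: "(\<Sum>k\<in>{1..r}. a k) \<le> (\<Sum>k\<in>{1..<s}. a k)" if "r < s" for r s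
    by (rule sum_mono2) (use that in auto)
  assume "r \<noteq> s"
  then show False
    using assms *[of r s] *[of s r] by (cases r s rule: linorder_cases) auto
qed

text \<open>Each column meets one row and row \<open>r\<close> owns \<open>a r\<close> columns, so
  grouping columns by rows produces the powers; an empty row gives an empty interval and the factor
  1.\<close>

lemma prod_diagram_minor:
  assumes M: "M \<in> carrier_mat n n"
  shows "(\<Prod>c\<in>fst ` composition_diagram n a. diagram_minor (diagram_column (composition_diagram n a) c) M)
    = (\<Prod>i=1..n. M $$ (i - 1, i - 1) ^ a i)"
proof -
  let ?C = "\<lambda>r. {(\<Sum>k\<in>{1..<r}. a k)<..(\<Sum>k\<in>{1..r}. a k)}"
  let ?D = "composition_diagram n a"
  have col: "diagram_column ?D c = {r}" if "r \<in> {1..n}" "c \<in> ?C r" for c r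
  proof -
    have "(c, s) \<in> ?D \<longleftrightarrow> s = r" for s
      using that composition_columns_disjoint[of c a s r] unfolding mem_composition_diagram by metis
    then show ?thesis
      by (simp add: diagram_column_def)
  qed
  have card: "card (?C r) = a r" if "r \<in> {1..n}" for r
    using that by (cases r) (auto simp: atLeastLessThanSuc_atLeastAtMost)
  have "(\<Prod>c\<in>fst ` ?D. diagram_minor (diagram_column ?D c) M)
      = (\<Prod>r=1..n. \<Prod>c\<in>?C r. diagram_minor (diagram_column ?D c) M)"
    unfolding fst_composition_diagram
  proof (rule prod.UNION_disjoint)
    show "\<forall>r\<in>{1..n}. \<forall>s\<in>{1..n}. r \<noteq> s \<longrightarrow> ?C r \<inter> ?C s = {}"
      using composition_columns_disjoint[of _ a] by (meson disjoint_iff)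
  qed simp_all
  also have "\<dots> = (\<Prod>r=1..n. \<Prod>c\<in>?C r. M $$ (r - 1, r - 1))"
    by (intro prod.cong refl) (simp only: col diagram_minor_singleton[OF M])
  also have "\<dots> = (\<Prod>i=1..n. M $$ (i - 1, i - 1) ^ a i)"
    by (intro prod.cong refl) (simp only: prod_constant card)
  finally show ?thesis .
qed

section \<open>The module as a span of monomials\<close>

text \<open>The forms involve exactly the entries on and below the diagonal, so their coefficients
  can be prescribed independently; nonzero diagonal values make the triangular matrix
  invertible.\<close>

lemma column_forms_from_borel:
  assumes "\<And>v. \<beta> v \<noteq> 0"
  obtains b where "b \<in> lower_borel n"
    "\<And>i. i \<in> {1..n} \<Longrightarrow> translate_generic n b $$ (i - 1, i - 1) = column_form \<beta> i"
proof -
  define b where "b = mat n n (\<lambda>(k, j). if j \<le> k then \<beta> (j, k) else 0)"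
  have b: "b \<in> carrier_mat n n"
    by (simp add: b_def)
  have "det b = prod_list (diag_mat b)"
    by (rule det_lower_triangular[OF _ b]) (auto simp: b_def)
  also have "\<dots> \<noteq> 0"
    using assms by (auto simp: prod_list_zero_iff diag_mat_def b_def)
  finally have "det b \<noteq> 0" .
  then have "b \<in> Units (ring_mat TYPE(complex) n ())"
    by (rule det_non_zero_imp_unit[OF b])
  then have "invertible_mat b"
    using b unfolding Units_def invertible_mat_def inverts_mat_def by (auto simp: ring_mat_def)
  then have lb: "b \<in> lower_borel n"
    using b by (auto simp: lower_borel_def b_def)
  have "translate_generic n b $$ (i - 1, i - 1) = column_form \<beta> i" if "i \<in> {1..n}" for i
    unfolding translate_generic_diagonal[OF lb that] column_form_def
    by (rule sum.cong) (use that in \<open>auto simp: b_def\<close>)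
  with lb show thesis by (rule that)
qed

lemma flagged_schur_module_eq_span_monomials:
  "flagged_schur_module n (composition_diagram n a)
    = cpoly.span ((\<lambda>m. Poly_Mapping.single m 1) ` family_monom n ` word_families n a)"
    (is "_ = cpoly.span ?B")
proof -
  let ?G = "word_families n a"
  define N where "N g = (\<Prod>i=1..n. arrangements (a i) {1..i} (g i))" for g
  define P where "P b = (\<Prod>i=1..n. translate_generic n b $$ (i - 1, i - 1) ^ a i)" for b
  have expand: "(\<Prod>i=1..n. column_form \<beta> i ^ a i)
      = (\<Sum>g\<in>?G. cpoly_scale (monom_eval \<beta> (family_monom n g))
          (Poly_Mapping.single (family_monom n g) (of_nat (N g))))" for \<beta>
    unfolding N_def by (rule prod_column_form)
  have "translate_generic n b \<in> carrier_mat n n" if "b \<in> lower_borel n" for b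
    using that by (auto simp: lower_borel_def translate_generic_def generic_matrix_def)
  then have module: "flagged_schur_module n (composition_diagram n a) = cpoly.span (P ` lower_borel n)"
    unfolding flagged_schur_module_def P_def
    by (intro arg_cong[of _ _ cpoly.span] image_cong refl prod_diagram_minor)
  have "P b \<in> cpoly.span ?B" if b: "b \<in> lower_borel n" for b
  proof -
    have "P b = (\<Prod>i=1..n. column_form (\<lambda>(j, k). b $$ (k, j)) i ^ a i)"
      unfolding P_def by (intro prod.cong refl) (simp only: translate_generic_diagonal[OF b])
    also have "\<dots> \<in> cpoly.span ?B"
      unfolding expand
    proof (intro cpoly.span_sum cpoly.span_scale)
      fix g assume "g \<in> ?G"
      then have "cpoly_scale (of_nat (N g)) (Poly_Mapping.single (family_monom n g) 1) \<in> cpoly.span ?B"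
        by (intro cpoly.span_scale cpoly.span_base) auto
      then show "Poly_Mapping.single (family_monom n g) (of_nat (N g)) \<in> cpoly.span ?B"
        by (simp add: cpoly_scale_single)
    qed
    finally show ?thesis .
  qed
  moreover have "Poly_Mapping.single (family_monom n g) 1 \<in> cpoly.span (P ` lower_borel n)"
    if g: "g \<in> ?G" for g
  proof -
    \<comment> \<open>The extraction lemma needs vectors indexed by monomials, whereas
      \<open>N\<close> depends on the family; injectivity allows the family to be recovered.\<close>
    define u :: "_ \<Rightarrow> (nat \<times> nat) cpoly" where
      "u m = Poly_Mapping.single m (of_nat (N (the_inv_into ?G (family_monom n) m)))" for m
    have "u (family_monom n g) \<in> cpoly.span (P ` lower_borel n)"
    proof (rule monomial_coefficients_in_subspace)
      fix \<beta> :: "nat \<times> nat \<Rightarrow> complex"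
      assume "\<And>v. \<beta> v \<noteq> 0"
      then obtain b where b: "b \<in> lower_borel n"
        and eq: "\<And>i. i \<in> {1..n} \<Longrightarrow> translate_generic n b $$ (i - 1, i - 1) = column_form \<beta> i"
        using column_forms_from_borel[of \<beta> n] by blast
      have "(\<Sum>m\<in>family_monom n ` ?G. cpoly_scale (monom_eval \<beta> m) (u m))
          = (\<Prod>i=1..n. column_form \<beta> i ^ a i)"
        unfolding expand
        by (subst sum.reindex[OF inj_on_family_monom])
           (auto simp: u_def the_inv_into_f_f[OF inj_on_family_monom] intro!: sum.cong)
      also have "\<dots> = P b"
        unfolding P_def by (intro prod.cong refl) (simp only: eq)
      also have "\<dots> \<in> cpoly.span (P ` lower_borel n)"
        by (intro cpoly.span_base imageI b)
      finally show "(\<Sum>m\<in>family_monom n ` ?G. cpoly_scale (monom_eval \<beta> m) (u m))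
          \<in> cpoly.span (P ` lower_borel n)" .
    qed (use g in \<open>auto simp: cpoly.subspace_span\<close>)
    then have "cpoly_scale (inverse (of_nat (N g))) (u (family_monom n g))
        \<in> cpoly.span (P ` lower_borel n)"
      by (rule cpoly.span_scale)
    \<comment> \<open>Positivity of the multinomial factor permits dividing by it in the complex
      numbers.\<close>
    moreover have "N g > 0"
      unfolding N_def using g by (intro prod_pos arrangements_pos) (auto simp: word_families_def)
    ultimately show ?thesis
      using g by (simp add: u_def the_inv_into_f_f[OF inj_on_family_monom] cpoly_scale_single)
  qed
  ultimately show ?thesis
    unfolding module cpoly.span_eq by blast
qed

section \<open>The diagonal action and its trace\<close>

text \<open>Left multiplication by a diagonal matrix scales row \<open>j\<close> of Y by
  \<open>x j\<close>, so these monomials are weight vectors. A general \<open>c\<close> covers the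
  scaled basis elements met in span induction.\<close>

lemma borel_act_family_monom:
  assumes "g \<in> word_families n a"
  shows "borel_act n (mat_diag n (\<lambda>i. x (Suc i))) (Poly_Mapping.single (family_monom n g) c)
    = cpoly_scale (monom_eval (\<lambda>(j, i). x (Suc j)) (family_monom n g))
        (Poly_Mapping.single (family_monom n g) c)"
proof -
  let ?d = "mat_diag n (\<lambda>i. x (Suc i))"
  have entry: "translate_generic n ?d $$ (j - 1, i - 1)
      = Poly_Mapping.single (Poly_Mapping.single (j - 1, i - 1) 1) (x (Suc (j - 1)))"
    if "i \<in> {1..n}" "j \<in> set (g i)" for i j
  proof -
    have "g i \<in> sorted_words (a i) {1..i}"
      using assms that by (auto simp: word_families_def)
    then have "j \<in> {1..i}"
      using that(2) by (auto simp: sorted_words_def)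
    then have "j - 1 < n" "i - 1 < n"
      using that(1) by auto
    \<comment> \<open>Pulling the case distinction out of the product lets the matrix product sum
      collapse to its diagonal term.\<close>
    moreover have "Const (if P then c else 0) * q = (if P then Const c * q else 0)"
      for P c and q :: "(nat \<times> nat) cpoly"
      by simp
    ultimately have "translate_generic n ?d $$ (j - 1, i - 1)
        = Const (x (Suc (j - 1))) * Var (j - 1, i - 1)"
      by (simp add: translate_generic_def generic_matrix_def scalar_prod_def mat_diag_def)
    then show ?thesis
      by (simp add: Const_def Var_def mult_single)
  qed
  have "monom_eval (\<lambda>ij. translate_generic n ?d $$ ij) (family_monom n g)
      = (\<Prod>i=1..n. \<Prod>j\<leftarrow>g i.
          Poly_Mapping.single (Poly_Mapping.single (j - 1, i - 1) 1) (x (Suc (j - 1))))"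
    unfolding monom_eval_family
    by (intro prod.cong arg_cong[of _ _ prod_list] map_cong refl entry)
  also have "\<dots> = Poly_Mapping.single (family_monom n g)
      (monom_eval (\<lambda>(j, i). x (Suc j)) (family_monom n g))"
    unfolding monom_eval_family unfolding family_monom_def
    by (simp add: prod_list_single prod_single)
  finally show ?thesis
    by (simp add: borel_act_def cpoly_subst_single cpoly_scale_single Const_def mult_single mult.commute)
qed

lemma borel_act_add: "borel_act n g (p + q) = borel_act n g p + borel_act n g q"
  unfolding borel_act_def by (rule cpoly_subst_add) (simp_all add: Const_add)

theorem theorem3p4:
  fixes n :: nat and a :: "nat \<Rightarrow> nat"
  assumes "n > 0"
  shows "is_borel_character n (flagged_schur_module n (composition_diagram n a)) (flagged_homogeneous n a)"
  unfolding is_borel_character_def cpoly_has_trace_on_def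
proof (intro allI impI conjI)
  fix x :: "nat \<Rightarrow> complex"
  let ?T = "borel_act n (mat_diag n (\<lambda>i. x (Suc i)))"
  let ?V = "flagged_schur_module n (composition_diagram n a)"
  let ?G = "word_families n a"
  let ?b = "\<lambda>g. Poly_Mapping.single (family_monom n g) (1::complex)"
  let ?w = "\<lambda>g. monom_eval (\<lambda>(j, i). x (Suc j)) (family_monom n g)"
  define B where "B = ?b ` ?G"
  have V: "?V = cpoly.span B"
    unfolding B_def by (simp add: flagged_schur_module_eq_span_monomials image_image)
  have indep: "cpoly.independent B"
    using independent_monomials[of "family_monom n ` ?G"] by (simp add: B_def image_image)
  \<comment> \<open>Each basis element is an eigenvector; additivity extends stability to the whole
    span.\<close>
  have "?T p \<in> cpoly.span B" if "p \<in> cpoly.span B" for p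
    using that
  proof (induction rule: cpoly.span_induct_alt)
    case base
    then show ?case
      by (simp add: borel_act_def cpoly_subst_def cpoly.span_zero)
  next
    case (step c v q)
    then obtain g where g: "g \<in> ?G" "v = ?b g"
      by (auto simp: B_def)
    have "?T (cpoly_scale c v) = cpoly_scale (?w g) (cpoly_scale c v)"
      using g by (simp add: cpoly_scale_single[of c] borel_act_family_monom)
    with step show ?case
      by (simp add: borel_act_add cpoly.span_add cpoly.span_scale cpoly.span_base)
  qed
  then show "?T ` ?V \<subseteq> ?V"
    unfolding V by blast
  have inj: "inj_on ?b ?G"
    using inj_on_family_monom by (auto simp: inj_on_def single_one_eq_iff)
  \<comment> \<open>Distinct families give distinct basis vectors, so the trace can be summed over
    families, each contributing its eigenvalue.\<close>
  have "(\<Sum>b\<in>B. cpoly.representation B (?T b) b)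
      = (\<Sum>g\<in>?G. cpoly.representation B (?T (?b g)) (?b g))"
    unfolding B_def by (simp add: sum.reindex[OF inj])
  also have "\<dots> = sum ?w ?G"
  proof (rule sum.cong)
    fix g assume "g \<in> ?G"
    then have "?b g \<in> B" and "?T (?b g) = cpoly_scale (?w g) (?b g)"
      by (auto simp: B_def borel_act_family_monom)
    then show "cpoly.representation B (?T (?b g)) (?b g) = ?w g"
      by (simp add: cpoly.representation_scale cpoly.representation_basis indep cpoly.span_base)
  qed simp
  finally have "cpoly_eval x (flagged_homogeneous n a) = (\<Sum>b\<in>B. cpoly.representation B (?T b) b)"
    by (simp add: eval_flagged_homogeneous)
  moreover have "finite B"
    by (simp add: B_def)
  ultimately show "\<exists>B. finite B \<and> cpoly.independent B \<and> cpoly.span B = ?V \<and>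
      cpoly_eval x (flagged_homogeneous n a) = (\<Sum>b\<in>B. cpoly.representation B (?T b) b)"
    using indep V by blast
qed

end
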